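(* Let $a,b,d\ge 1$ be integers with $\gcd(a,b)=1$, and let $\rho=dab(a+b)$. For integers $t>da$ with $\gcd(t,d)=1$, let $M_t=\langle t-da,\,t,\,t+db\rangle$ and let $Gr(M_t)$ be its Graver basis (with respect to these three generators). Then for $t\gg 0$, $|Gr(M_t)|$ coincides with a quasilinear function of $t$ with period $\rho$ and leading coefficient $2/(ab)$; that is, there exist an integer $N$ and a $\rho$-periodic function $c:\mathbb Z\to\mathbb Q$ such that $|Gr(M_t)|=\frac{2}{ab}\,t+c(t)$ for all $t>N$ with $\gcd(t,d)=1$. In particular, $$|Gr(M_{t+\rho})|=|Gr(M_t)|+2d(a+b)$$ for all sufficiently large $t$ with $\gcd(t,d)=1$.
   Context: For $t>da$ with $\gcd(t,d)=1$, $M_t=\langle t-da,t,t+db\rangle$ is the numerical semigroup generated by (not necessarily minimally) $t-da,t,t+db$. The trade lattice is $\mathbb L_t=\{(v_0,v_1,v_2)\in\mathbb Z^3 : (t-da)v_0+tv_1+(t+db)v_2=0\}$, whose elements are called trades. The Graver basis $Gr(M_t)\subseteq\mathbb L_t$ is the (finite) set of nonzero trades that cannot be written as a sum of two nonzero trades lying in the same closed orthant of $\mathbb R^3$ (i.e. $\mathbf v\ne 0$ is in $Gr(M_t)$ iff there are no nonzero $\mathbf u,\mathbf w\in\mathbb L_t$ with $\mathbf v=\mathbf u+\mathbf w$ and $u_iw_i\ge 0$ for all $i$). *)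

theory Defs
  imports "HOL-Analysis.Analysis"
begin

definition trade_lattice :: "int ^ 'k \<Rightarrow> (int ^ 'k) set" where
  "trade_lattice n = {v. (\<Sum>i\<in>UNIV. n $ i * v $ i) = 0}"

text \<open>Two vectors lie in a common closed orthant iff no coordinate has opposite strict signs.\<close>

definition same_orthant :: "int ^ 'k \<Rightarrow> int ^ 'k \<Rightarrow> bool" where
  "same_orthant u w \<longleftrightarrow> (\<forall>i. u $ i * w $ i \<ge> 0)"

text \<open>
  The Graver basis belongs to a tuple of generators rather than to the semigroup they generate:
  the generators need not be minimal. Both \<open>v\<close> and \<open>- v\<close> are counted.
\<close>

definition graver_basis :: "int ^ 'k \<Rightarrow> (int ^ 'k) set" where
  "graver_basis n = {v \<in> trade_lattice n. v \<noteq> 0 \<and>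
     \<not> (\<exists>u\<in>trade_lattice n. \<exists>w\<in>trade_lattice n.
          u \<noteq> 0 \<and> w \<noteq> 0 \<and> same_orthant u w \<and> v = u + w)}"

text \<open>The generators of \<open>M\<^sub>t\<close>; the type \<open>3\<close> indexes coordinates by 1, 2, 3 (not 0, 1, 2).\<close>

definition M_gens :: "int \<Rightarrow> int \<Rightarrow> int \<Rightarrow> int \<Rightarrow> int ^ 3" where
  "M_gens a b d t = vector [t - d * a, t, t + d * b]"

lemma trade_lattice_M_gens:
  "v \<in> trade_lattice (M_gens a b d t) \<longleftrightarrow>
     (t - d * a) * v $ 1 + t * v $ 2 + (t + d * b) * v $ 3 = 0"
  by (simp add: trade_lattice_def M_gens_def sum_3)

end

theory Submission
  imports Defs
begin

text \<open>
  The trades \<open>v\<close> satisfy \<open>t (v\<^sub>1 + v\<^sub>2 + v\<^sub>3) = d (a v\<^sub>1 - b v\<^sub>3)\<close>. Since \<open>t\<close> and \<open>d\<close> are coprime,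
  every trade has an integer \<^emph>\<open>degree\<close> \<open>m\<close> with \<open>v\<^sub>1 + v\<^sub>2 + v\<^sub>3 = d m\<close> and \<open>a v\<^sub>1 - b v\<^sub>3 = t m\<close>.
  The degree is additive and negation reverses its sign, so the Graver basis is counted degree by
  degree, up to sign. Let \<open>t\<close> be large.

  Degree \<open>0\<close>: these trades are the multiples of the circuit \<open>(b, -(a + b), a)\<close>, so exactly
  \<open>\<plusminus>(b, -(a + b), a)\<close> are irreducible.

  Degree \<open>1\<close>: a trade is an integer point \<open>(x, z)\<close> of the line \<open>a x - b z = t\<close>. It is reducible exactly
  when the circuit or its negative can be split off, so the irreducible ones satisfy \<open>x > -b\<close> and
  \<open>z < a\<close> (\<open>deg_one_Gr_iff\<close>). Integer points on the line are \<open>(b, a)\<close> apart, so the number of irreducible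
  ones grows by one whenever \<open>t\<close> grows by \<open>a b\<close> (\<open>card_line_points_step\<close>). This is the whole linear growth; counting
  both signs gives the slope \<open>2/(a b)\<close>.

  Degree at least \<open>2\<close>: away from the three lines on which a coordinate vanishes, there is room to split
  off the circuit, its negative, or a trade of degree \<open>1\<close> (\<open>deg_ge_two_Gr_near_ray\<close>). Close to such a line the
  two other coordinates are huge and of opposite signs, so they never obstruct a decomposition. What
  remains is a question about the pairs (degree, small coordinate) in a lattice that depends only on
  \<open>t\<close> modulo \<open>b\<close>, \<open>a + b\<close> or \<open>a\<close> (\<open>near_ray_Gr_iff\<close>), and its answer is a finite set. These three sets
  contribute a periodic number of elements.
\<close>

section \<open>Lattice points on a line\<close>

lemma residue_in_window:
  fixes p q n L :: int
  assumes "coprime p q" and "q > 0"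
  obtains x where "L \<le> x" "x < L + q" "q dvd n - p * x"
proof -
  from assms(1) obtain u v where uv: "u * p + v * q = 1"
    by (metis bezout_int coprime_iff_gcd_eq_1)
  define x where "x = L + (u * n - L) mod q"
  have "x = u * n - q * ((u * n - L) div q)"
    unfolding x_def by (simp add: minus_mult_div_eq_mod [symmetric])
  hence "p * x = p * (u * n - q * ((u * n - L) div q))" by simp
  hence "n - p * x = n * (1 - u * p) + q * (p * ((u * n - L) div q))"
    by (simp add: algebra_simps)
  also have "1 - u * p = v * q" using uv by simp
  finally have "n - p * x = q * (n * v + p * ((u * n - L) div q))"
    by (simp add: algebra_simps)
  hence "q dvd n - p * x" by simp
  moreover have "L \<le> x" "x < L + q"
    using assms(2) by (simp_all add: x_def)
  ultimately show thesis using that by blast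
qed

text \<open>
  The integer points of \<open>p x + q y = n\<close> have \<open>x\<close>-coordinates in one residue class modulo \<open>q\<close>, so it is
  enough that the admissible \<open>x'\<close> fill an interval of length at least \<open>q\<close>. Its left end is \<open>0\<close> or
  \<open>(n - q y) / p\<close> and its right end is \<open>x\<close> or \<open>n / p\<close>; the four inequalities \<open>p q \<le> n\<close>, \<open>2 n \<le> p x + q y\<close>,
  \<open>q \<le> x\<close> and \<open>p \<le> y\<close> make all four possible lengths large enough.
\<close>

lemma lattice_point_below:
  fixes p q n m x y :: int
  assumes "0 < p" "0 < q" "coprime p q" "p * q \<le> n" "2 * n \<le> p * x + q * y"
    and "q \<le> x" "p \<le> y"
  obtains x' y' where "p * x' + q * y' = n" "0 \<le> x'" "x' \<le> x" "0 \<le> y'" "y' \<le> y"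
proof -
  \<comment> \<open>The ceiling of \<open>(n - q y) / p\<close>: the bound \<open>y' \<le> y\<close> says \<open>x' \<ge> e\<close>.\<close>
  define e where "e = - ((q * y - n) div p)"
  define L where "L = max 0 e"
  obtain x' where x': "L \<le> x'" "x' < L + q" "q dvd n - p * x'"
    using residue_in_window [OF assms(3,2)] by blast
  from x'(3) obtain y' where y': "n - p * x' = q * y'" by (elim dvdE)
  have e: "n - q * y \<le> p * e" "p * e < n - q * y + p"
  proof -
    have "q * y - n = p * ((q * y - n) div p) + (q * y - n) mod p" by simp
    moreover have "0 \<le> (q * y - n) mod p" "(q * y - n) mod p < p" using assms(1) by auto
    moreover have "p * e = - (p * ((q * y - n) div p))" by (simp add: e_def)
    ultimately show "n - q * y \<le> p * e" "p * e < n - q * y + p" by linarith+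
  qed
  have "p * e \<le> p * x'" using x'(1) assms(1) by (simp add: L_def)
  hence "q * y' \<le> q * y" using e(1) y' by linarith
  hence 1: "y' \<le> y" using assms(2) by simp
  have "p * x' \<le> p * (L + q - 1)" using x'(2) assms(1) by simp
  hence px: "p * x' \<le> p * L + p * q - p" by (simp add: algebra_simps)
  have qy: "p * q \<le> q * y" using assms by (simp add: mult.commute)
  have "p * x' \<le> n \<and> x' \<le> x"
  proof (cases "e \<le> 0")
    case True
    hence "L = 0" by (simp add: L_def)
    thus ?thesis using px x'(2) assms by auto
  next
    case False
    hence L: "L = e" by (simp add: L_def)
    have "p * x' < p * x" using px e(2) assms(4,5) unfolding L by linarith
    hence "x' \<le> x" using assms(1) by simp
    moreover have "p * x' \<le> n" using px e(2) qy unfolding L by linarith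
    ultimately show ?thesis by simp
  qed
  moreover from this have "0 \<le> q * y'" using y' by linarith
  hence "0 \<le> y'" using assms(2) by (simp add: zero_le_mult_iff)
  ultimately show thesis using that [of x' y'] x'(1) y' 1 by (simp add: L_def)
qed

text \<open>
  The window \<open>x > -b\<close>, \<open>z < a\<close> keeps exactly the points \<open>(x, z)\<close> of the line from which neither \<open>(b, a)\<close>
  nor \<open>-(b, a)\<close> can be split off without a coordinate changing sign.
\<close>

definition line_points :: "int \<Rightarrow> int \<Rightarrow> int \<Rightarrow> (int \<times> int) set" where
  "line_points a b t = {(x, z). a * x - b * z = t \<and> - b < x \<and> z < a}"

lemma finite_line_points:
  assumes "a \<ge> 1" "b \<ge> 1" "t \<ge> 0"
  shows "finite (line_points a b t)"
proof -
  have small: "y < K" if "s * y < K" "s \<ge> 1" "K > 0" for s y K :: int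
  proof (cases "y \<le> 0")
    case False
    hence "1 * y \<le> s * y" using that by (intro mult_right_mono) auto
    thus ?thesis using that by simp
  qed (use that in simp)
  have K: "t + a * b > 0" using assms by (simp add: add_nonneg_pos)
  have "line_points a b t \<subseteq> {-b..t + a * b} \<times> {- (t + a * b)..a}"
  proof clarify
    fix x z assume "(x, z) \<in> line_points a b t"
    hence h: "a * x - b * z = t" "- b < x" "z < a" by (auto simp: line_points_def)
    have "b * z < b * a" "a * (- b) < a * x"
      using h assms by (simp_all only: mult_less_cancel_left_pos)
    hence "a * x < t + a * b" "b * (- z) < t + a * b"
      using h(1) by (simp_all add: algebra_simps)
    hence "x < t + a * b" "- z < t + a * b" using small assms K by blast+
    thus "x \<in> {-b..t + a * b} \<and> z \<in> {- (t + a * b)..a}" using h by auto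
  qed
  thus ?thesis by (rule finite_subset) auto
qed

text \<open>
  Translation by \<open>(b, 0)\<close> carries the line for \<open>t\<close> to the line for \<open>t + a b\<close>. It covers every point
  of the new window with \<open>x > 0\<close>, and exactly one point of the new line has its \<open>x\<close>-coordinate among the \<open>b\<close> consecutive
  integers in the half-open interval from \<open>-b\<close> (excluded) to \<open>0\<close>.
\<close>

lemma card_line_points_step:
  assumes "a \<ge> 1" "b \<ge> 1" "coprime a b" "t \<ge> 0"
  shows "card (line_points a b (t + a * b)) = card (line_points a b t) + 1"
proof -
  obtain x0 where x0: "1 - b \<le> x0" "x0 < 1 - b + b" "b dvd t + a * b - a * x0"
    using residue_in_window [OF assms(3), of "1 - b" "t + a * b"] assms(2) by auto
  from x0(3) obtain w where w: "t + a * b - a * x0 = b * w" by (elim dvdE)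
  let ?f = "\<lambda>(x, z). (x + b, z :: int)"
  \<comment> \<open>A point this far to the left automatically meets the bound on \<open>z\<close>, because \<open>t \<ge> 0\<close>.\<close>
  have "a * x0 \<le> 0" using x0 assms by (simp add: mult_nonneg_nonpos)
  hence "b * w \<ge> a * b" using w assms by linarith
  hence "a * b \<le> w * b" by (simp add: mult.commute)
  hence "w \<ge> a" using assms by simp
  have "line_points a b (t + a * b) = insert (x0, - w) (?f ` line_points a b t)"
  proof (intro set_eqI iffI)
    fix v assume "v \<in> line_points a b (t + a * b)"
    then obtain x z where v: "v = (x, z)" "a * x - b * z = t + a * b" "- b < x" "z < a"
      by (auto simp: line_points_def)
    show "v \<in> insert (x0, - w) (?f ` line_points a b t)"
    proof (cases "x > 0")
      case True
      have "(x - b, z) \<in> line_points a b t"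
        using v True by (simp add: line_points_def algebra_simps)
      hence "?f (x - b, z) \<in> ?f ` line_points a b t" by (rule imageI)
      thus ?thesis using v by simp
    next
      case False
      have "a * (x - x0) = b * (z + w)" using v(2) w by (simp add: algebra_simps)
      hence "b dvd x - x0" using assms(3)
        by (metis coprime_commute coprime_dvd_mult_right_iff dvd_triv_left)
      moreover have "\<bar>x - x0\<bar> < b" using False v(3) x0 by linarith
      ultimately have x: "x = x0" using zdvd_imp_le [of b "\<bar>x - x0\<bar>"] by fastforce
      hence "b * z = b * (- w)" using v(2) w by (simp add: algebra_simps)
      hence "z = - w" using assms(2) by (metis mult_cancel_left not_one_le_zero)
      thus ?thesis using v x by simp
    qed
  next
    fix v assume "v \<in> insert (x0, - w) (?f ` line_points a b t)"
    thus "v \<in> line_points a b (t + a * b)"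
    proof
      assume "v = (x0, - w)"
      thus ?thesis using x0 w \<open>w \<ge> a\<close> assms by (simp add: line_points_def)
    next
      assume "v \<in> ?f ` line_points a b t"
      thus ?thesis using assms by (auto simp: line_points_def algebra_simps)
    qed
  qed
  moreover have "(x0, - w) \<notin> ?f ` line_points a b t"
    using x0 by (auto simp: line_points_def)
  moreover have "inj_on ?f (line_points a b t)" by (auto simp: inj_on_def)
  ultimately show ?thesis
    using finite_line_points [OF assms(1,2,4)] by (simp add: card_image)
qed

lemma card_line_points:
  assumes "a \<ge> 1" "b \<ge> 1" "coprime a b" "t \<ge> 0"
  shows "card (line_points a b (t + int k * (a * b))) = card (line_points a b t) + k"
proof (induction k)
  case (Suc k)
  have e: "t + int (Suc k) * (a * b) = (t + int k * (a * b)) + a * b"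
    by (simp add: algebra_simps)
  have "0 \<le> t + int k * (a * b)" using assms by simp
  from card_line_points_step [OF assms(1-3) this] show ?case unfolding e using Suc.IH by linarith
qed simp

section \<open>Irreducible pairs of degree and small coordinate\<close>

text \<open>
  The generators are \<open>t + d \<alpha>\<close>, \<open>t + d \<beta>\<close>, \<open>t + d \<gamma>\<close> in some order. A trade is determined by its
  degree \<open>m\<close> and its \<open>\<alpha>\<close>-coordinate \<open>r\<close>; the pairs \<open>(m, r)\<close> that occur are those for which the
  \<open>\<beta>\<close>-coordinate, obtained by eliminating the \<open>\<gamma>\<close>-coordinate, is an integer.
\<close>

definition ray_lattice :: "int \<Rightarrow> int \<Rightarrow> int \<Rightarrow> int \<Rightarrow> int \<Rightarrow> (int \<times> int) set" where
  "ray_lattice \<alpha> \<beta> \<gamma> d t = {(m, r). (\<gamma> - \<beta>) dvd (t + d * \<gamma>) * m - (\<gamma> - \<alpha>) * r}"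

text \<open>
  The irreducible pairs with \<open>\<bar>r\<bar> < \<gamma> - \<beta>\<close> and degree at least \<open>2\<close>, where a summand must have
  positive degree and an \<open>r\<close>-part of the same sign. No sign condition mentions the two other coordinates,
  which is why the set depends on \<open>t\<close> only through a congruence.
\<close>

definition ray_atoms :: "int \<Rightarrow> int \<Rightarrow> int \<Rightarrow> int \<Rightarrow> int \<Rightarrow> (int \<times> int) set" where
  "ray_atoms \<alpha> \<beta> \<gamma> d t = {(m, r). (m, r) \<in> ray_lattice \<alpha> \<beta> \<gamma> d t \<and> 2 \<le> m \<and> \<bar>r\<bar> < \<gamma> - \<beta> \<and>
     \<not> (\<exists>m' r'. (m', r') \<in> ray_lattice \<alpha> \<beta> \<gamma> d t \<and> 0 < m' \<and> m' < m \<and> 0 \<le> r' * (r - r'))}"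

lemma ray_atoms_periodic:
  assumes "\<gamma> - \<beta> dvd s"
  shows "ray_atoms \<alpha> \<beta> \<gamma> d (t + s) = ray_atoms \<alpha> \<beta> \<gamma> d t"
proof -
  have "\<gamma> - \<beta> dvd (t + s + d * \<gamma>) * m - (\<gamma> - \<alpha>) * r
      \<longleftrightarrow> \<gamma> - \<beta> dvd (t + d * \<gamma>) * m - (\<gamma> - \<alpha>) * r" for m r
  proof -
    have "(t + s + d * \<gamma>) * m - (\<gamma> - \<alpha>) * r = s * m + ((t + d * \<gamma>) * m - (\<gamma> - \<alpha>) * r)"
      by (simp add: algebra_simps)
    thus ?thesis using assms by (simp only: dvd_add_right_iff dvd_mult2)
  qed
  hence "ray_lattice \<alpha> \<beta> \<gamma> d (t + s) = ray_lattice \<alpha> \<beta> \<gamma> d t"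
    unfolding ray_lattice_def by simp
  thus ?thesis unfolding ray_atoms_def by simp
qed

lemma finite_ray_atoms: "finite (ray_atoms \<alpha> \<beta> \<gamma> d t)"
proof -
  let ?q = "\<gamma> - \<beta>"
  have "ray_atoms \<alpha> \<beta> \<gamma> d t \<subseteq> {2..?q} \<times> {-?q..?q}"
  proof clarify
    fix m r assume h: "(m, r) \<in> ray_atoms \<alpha> \<beta> \<gamma> d t"
    \<comment> \<open>The pair \<open>(\<gamma> - \<beta>, 0)\<close> can be split off from every pair of larger degree.\<close>
    have "(?q, 0) \<in> ray_lattice \<alpha> \<beta> \<gamma> d t" by (simp add: ray_lattice_def)
    moreover have "\<bar>r\<bar> < ?q" "2 \<le> m" using h by (auto simp: ray_atoms_def)
    ultimately have "m \<le> ?q" using h unfolding ray_atoms_def by fastforce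
    thus "m \<in> {2..?q} \<and> r \<in> {-?q..?q}" using \<open>\<bar>r\<bar> < ?q\<close> \<open>2 \<le> m\<close> by auto
  qed
  thus ?thesis by (rule finite_subset) auto
qed

section \<open>The degree of a trade\<close>

lemma sub_interval_iff:
  fixes p q :: int
  shows "0 \<le> p * (q - p) \<longleftrightarrow> (0 \<le> p \<and> p \<le> q) \<or> (q \<le> p \<and> p \<le> 0)"
  by (auto simp: zero_le_mult_iff)

text \<open>
  The term \<open>2 (a + b)\<^sup>2\<close> in the bound on \<open>t\<close> dominates every product of a coordinate smaller than
  \<open>a + b\<close> with a difference of shifts, twice: once for the sign of the other two coordinates near a ray,
  and once more to keep these coordinates above \<open>a + b\<close>, so that the three rays stay apart.
\<close>

locale shifted_generators =
  fixes a b d t :: int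
  assumes a1: "a \<ge> 1" and b1: "b \<ge> 1" and d1: "d \<ge> 1"
    and cop: "coprime a b" and copt: "coprime t d"
    and large: "t > d * (a + b) + 2 * (a + b)\<^sup>2"
begin

definition L :: "(int ^ 3) set" where "L = trade_lattice (M_gens a b d t)"

definition Gr :: "(int ^ 3) set" where "Gr = graver_basis (M_gens a b d t)"

definition deg :: "int ^ 3 \<Rightarrow> int" where "deg v = (v $ 1 + v $ 2 + v $ 3) div d"

definition shift :: "int ^ 3" where "shift = vector [- a, 0, b]"

lemma shift_nth [simp]: "shift $ 1 = - a" "shift $ 2 = 0" "shift $ 3 = b"
  by (simp_all add: shift_def)

lemma deg_zero_vec: "deg 0 = 0"
  by (simp add: deg_def)

lemma tradeI:
  assumes "v $ 1 + v $ 2 + v $ 3 = d * m" "a * v $ 1 - b * v $ 3 = t * m"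
  shows "v \<in> L" "deg v = m"
proof -
  have "(t - d * a) * v $ 1 + t * v $ 2 + (t + d * b) * v $ 3
      = t * (v $ 1 + v $ 2 + v $ 3) - d * (a * v $ 1 - b * v $ 3)"
    by (simp add: algebra_simps)
  also have "\<dots> = 0" unfolding assms by simp
  finally show "v \<in> L" by (simp add: L_def trade_lattice_M_gens)
  show "deg v = m" unfolding deg_def assms using d1 by simp
qed

text \<open>
  Here coprimality of \<open>t\<close> and \<open>d\<close> enters: \<open>d\<close> divides \<open>t (v\<^sub>1 + v\<^sub>2 + v\<^sub>3)\<close>, hence the coordinate sum,
  so that the division in the definition of \<open>deg\<close> is exact.
\<close>

lemma tradeD:
  assumes "v \<in> L"
  shows "v $ 1 + v $ 2 + v $ 3 = d * deg v" "a * v $ 1 - b * v $ 3 = t * deg v"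
proof -
  let ?s = "v $ 1 + v $ 2 + v $ 3"
  have *: "t * ?s = d * (a * v $ 1 - b * v $ 3)"
    using assms by (simp add: L_def trade_lattice_M_gens algebra_simps)
  hence "d dvd t * ?s" by simp
  hence "d dvd ?s" using copt by (simp add: coprime_commute coprime_dvd_mult_right_iff)
  thus s: "?s = d * deg v" by (simp add: deg_def)
  have "d * (a * v $ 1 - b * v $ 3) = d * (t * deg v)"
    using * unfolding s by (simp add: algebra_simps)
  thus "a * v $ 1 - b * v $ 3 = t * deg v" using d1 by (metis mult_cancel_left not_one_le_zero)
qed

lemma uminus_trade: "v \<in> L \<Longrightarrow> - v \<in> L" "v \<in> L \<Longrightarrow> deg (- v) = - deg v"
  using tradeI [of "- v" "- deg v"] tradeD [of v] by (simp_all add: algebra_simps)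

lemma diff_trade:
  assumes "u \<in> L" "v \<in> L"
  shows "v - u \<in> L" "deg (v - u) = deg v - deg u"
  using tradeI [of "v - u" "deg v - deg u"] tradeD [OF assms(1)] tradeD [OF assms(2)]
  by (simp_all add: algebra_simps)

text \<open>
  Coordinatewise, \<open>u\<close> lies between \<open>0\<close> and \<open>v\<close>. Equivalently \<open>u\<close> and \<open>v - u\<close> lie in a common closed
  orthant, so \<open>u\<close> is a possible summand of \<open>v\<close>.
\<close>

definition conformal :: "int ^ 3 \<Rightarrow> int ^ 3 \<Rightarrow> bool" where
  "conformal u v \<longleftrightarrow> (\<forall>l. 0 \<le> u $ l * (v $ l - u $ l))"

lemma Gr_iff:
  "v \<in> Gr \<longleftrightarrow> v \<in> L \<and> v \<noteq> 0 \<and> \<not> (\<exists>u\<in>L. u \<noteq> 0 \<and> u \<noteq> v \<and> conformal u v)"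
proof -
  have "(\<exists>u\<in>L. \<exists>w\<in>L. u \<noteq> 0 \<and> w \<noteq> 0 \<and> same_orthant u w \<and> v = u + w) \<longleftrightarrow>
      (\<exists>u\<in>L. u \<noteq> 0 \<and> u \<noteq> v \<and> conformal u v)" (is "?l \<longleftrightarrow> ?r") if v: "v \<in> L"
  proof
    assume ?l
    then obtain u w where "u \<in> L" "w \<in> L" "u \<noteq> 0" "w \<noteq> 0" "same_orthant u w" "v = u + w"
      by blast
    thus ?r by (intro bexI [of _ u]) (auto simp: same_orthant_def conformal_def)
  next
    assume ?r
    then obtain u where u: "u \<in> L" "u \<noteq> 0" "u \<noteq> v" "conformal u v" by blast
    show ?l
      by (rule bexI [OF _ u(1)], rule bexI [OF _ diff_trade(1) [OF u(1) v]])
         (use u in \<open>auto simp: same_orthant_def conformal_def\<close>)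
  qed
  thus ?thesis unfolding Gr_def graver_basis_def L_def by auto
qed

lemma uminus_Gr: "v \<in> Gr \<Longrightarrow> - v \<in> Gr"
proof -
  assume v: "v \<in> Gr"
  have "conformal (- u) v" if "conformal u (- v)" for u
  proof -
    have *: "(- u) $ l * (v $ l - (- u) $ l) = u $ l * ((- v) $ l - u $ l)" for l
      by (simp add: algebra_simps)
    show ?thesis using that by (simp only: conformal_def * simp_thms)
  qed
  moreover have "- u \<noteq> v" if "u \<noteq> - v" for u using that by auto
  ultimately show ?thesis using v uminus_trade(1) unfolding Gr_iff
    by (metis neg_equal_0_iff_equal)
qed

lemma conformal_cases:
  assumes "conformal u v"
  shows "(0 \<le> u $ l \<and> u $ l \<le> v $ l) \<or> (v $ l \<le> u $ l \<and> u $ l \<le> 0)"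
  using assms by (auto simp: conformal_def sub_interval_iff)

lemma large_facts:
  "t > 2 * (a * b)" "t > d * a" "t - d * a > 2 * (a * (a + b))"
  "t + d * b > 2 * (b * (a + b))" "t - d * a > 2 * (a + b)\<^sup>2" "a * b \<ge> 1" "d * b \<ge> 1"
proof -
  have "d * a \<ge> 1" using mult_mono [of 1 d 1 a] a1 d1 by auto
  moreover show "a * b \<ge> 1" "d * b \<ge> 1"
    using mult_mono [of 1 a 1 b] mult_mono [of 1 d 1 b] a1 b1 d1 by auto
  ultimately have pos: "d * a \<ge> 1" "a * b \<ge> 1" "d * b \<ge> 1" by simp_all
  have sq: "(a + b)\<^sup>2 = a * (a + b) + b * (a + b)" "a * (a + b) = a * a + a * b"
    "b * (a + b) = a * b + b * b" "a * a \<ge> 0" "b * b \<ge> 0" "d * (a + b) = d * a + d * b"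
    by (simp_all add: power2_eq_square algebra_simps)
  show "t > 2 * (a * b)" "t > d * a" "t - d * a > 2 * (a * (a + b))"
    "t + d * b > 2 * (b * (a + b))" "t - d * a > 2 * (a + b)\<^sup>2"
    using large sq pos by linarith+
qed

section \<open>Degree zero\<close>

definition circuit :: "int ^ 3" where "circuit = vector [b, - (a + b), a]"

lemma circuit_nth [simp]: "circuit $ 1 = b" "circuit $ 2 = - (a + b)" "circuit $ 3 = a"
  by (simp_all add: circuit_def)

lemma circuit_trade: "circuit \<in> L" "deg circuit = 0"
  using tradeI [of circuit 0] by simp_all

lemma circuit_nonzero: "circuit \<noteq> 0"
  using a1 by (auto simp: vec_eq_iff forall_3)

lemma conformal_circuit:
  assumes "b \<le> v $ 1" "v $ 2 \<le> - (a + b)" "a \<le> v $ 3"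
  shows "conformal circuit v"
  unfolding conformal_def sub_interval_iff forall_3 using assms a1 b1 by simp

lemma uminus_circuit: "- circuit \<in> L" "deg (- circuit) = 0" "- circuit \<noteq> 0"
  using circuit_trade circuit_nonzero uminus_trade by simp_all

lemma conformal_uminus_circuit:
  assumes "v $ 1 \<le> - b" "a + b \<le> v $ 2" "v $ 3 \<le> - a"
  shows "conformal (- circuit) v"
  unfolding conformal_def sub_interval_iff forall_3 using assms a1 b1 by simp

lemma deg_zero_trade:
  assumes "v \<in> L" "deg v = 0"
  obtains k where "v $ 1 = k * b" "v $ 2 = - k * (a + b)" "v $ 3 = k * a"
proof -
  have e: "a * v $ 1 = b * v $ 3" "v $ 1 + v $ 2 + v $ 3 = 0" using tradeD [OF assms(1)] assms by auto
  have "b dvd v $ 1" using e(1) cop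
    by (metis coprime_commute coprime_dvd_mult_right_iff dvd_triv_left)
  then obtain k where k: "v $ 1 = b * k" by (elim dvdE)
  hence "b * v $ 3 = b * (a * k)" using e(1) by (metis mult.left_commute)
  hence "v $ 3 = a * k" using b1 by (metis mult_cancel_left not_one_le_zero)
  thus thesis using that [of k] k e(2) by (simp add: algebra_simps)
qed

text \<open>
  A summand \<open>u\<close> of the circuit has coordinates bounded by \<open>a\<close> and \<open>b\<close>, so \<open>a u\<^sub>1 - b u\<^sub>3\<close> is smaller
  in absolute value than \<open>t\<close>. Being a multiple of \<open>t\<close> it vanishes, and \<open>u\<close> is a multiple of the circuit.
\<close>

lemma circuit_Gr: "circuit \<in> Gr"
proof -
  have False if u: "u \<in> L" "u \<noteq> 0" "u \<noteq> circuit" "conformal u circuit" for u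
  proof -
    have x: "0 \<le> u $ 1" "u $ 1 \<le> b" "0 \<le> u $ 3" "u $ 3 \<le> a"
      using conformal_cases [OF u(4), of 1] conformal_cases [OF u(4), of 3] a1 b1 by auto
    have "0 \<le> a * u $ 1" "a * u $ 1 \<le> a * b" "0 \<le> b * u $ 3" "b * u $ 3 \<le> b * a"
      using x a1 b1 by simp_all
    hence "\<bar>t * deg u\<bar> \<le> a * b" using tradeD(2) [OF u(1)] by (simp add: mult.commute)
    hence "\<bar>t * deg u\<bar> < t" using large_facts by linarith
    hence "deg u = 0" using large_facts zdvd_not_zless [of "\<bar>t * deg u\<bar>" t]
      by (metis abs_ge_zero dvd_abs_iff dvd_triv_left less_le mult_eq_0_iff abs_eq_0 less_irrefl not_less)
    then obtain k where k: "u $ 1 = k * b" "u $ 2 = - k * (a + b)" "u $ 3 = k * a"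
      using deg_zero_trade u(1) by blast
    have "0 \<le> k" "k \<le> 1" using x k b1 by (simp_all add: zero_le_mult_iff)
    hence "k = 0 \<or> k = 1" by linarith
    thus False using k u by (auto simp: vec_eq_iff forall_3)
  qed
  thus ?thesis using circuit_trade circuit_nonzero unfolding Gr_iff by blast
qed

lemma Gr_deg_zero: "{v \<in> Gr. deg v = 0} = {circuit, - circuit}"
proof (intro set_eqI iffI)
  fix v assume "v \<in> {v \<in> Gr. deg v = 0}"
  hence v: "v \<in> Gr" "deg v = 0" by auto
  then obtain k where k: "v $ 1 = k * b" "v $ 2 = - k * (a + b)" "v $ 3 = k * a"
    using deg_zero_trade unfolding Gr_iff by blast
  show "v \<in> {circuit, - circuit}"
  proof (rule ccontr)
    assume n: "v \<notin> {circuit, - circuit}"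
    have "k \<noteq> 0" using v k unfolding Gr_iff by (auto simp: vec_eq_iff forall_3)
    have mono: "s * y \<le> s * y'" if "y \<le> y'" "s \<ge> 1" for s y y' :: int
      using that by simp
    show False
    proof (cases "k > 0")
      case True
      hence "k * b \<ge> b" "k * a \<ge> a" "k * (a + b) \<ge> a + b"
        using mono [of 1 k b] mono [of 1 k a] mono [of 1 k "a + b"] a1 b1
        by (simp_all add: mult.commute)
      hence "v $ 1 \<ge> b" "v $ 3 \<ge> a" "v $ 2 \<le> - (a + b)" unfolding k by linarith+
      hence "conformal circuit v" by (intro conformal_circuit)
      thus False using v(1) n circuit_trade circuit_nonzero unfolding Gr_iff by auto
    next
      case False
      hence "k \<le> -1" using \<open>k \<noteq> 0\<close> by simp
      hence "k * b \<le> - b" "k * a \<le> - a" "- k * (a + b) \<ge> a + b"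
        using mono [of k "-1" b] mono [of k "-1" a] mono [of 1 "- k" "a + b"] a1 b1
        by (simp_all add: mult.commute)
      hence "v $ 1 \<le> - b" "v $ 3 \<le> - a" "v $ 2 \<ge> a + b" unfolding k by linarith+
      hence "conformal (- circuit) v" using a1 b1 by (intro conformal_uminus_circuit) auto
      thus False using v(1) n uminus_circuit unfolding Gr_iff by auto
    qed
  qed
next
  fix v assume "v \<in> {circuit, - circuit}"
  thus "v \<in> {v \<in> Gr. deg v = 0}" using circuit_Gr uminus_Gr circuit_trade uminus_trade by auto
qed

section \<open>Degree one\<close>

text \<open>
  If \<open>v\<^sub>3 \<ge> a\<close>, then \<open>v\<^sub>1\<close> is large positive and \<open>v\<^sub>2\<close> is large negative, so the circuit splits off; if
  \<open>v\<^sub>1 \<le> -b\<close>, its negative does. Conversely a proper summand of \<open>v\<close> or its complement has degree at most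
  \<open>0\<close>. Degree \<open>0\<close> means a nonzero multiple of the circuit, and negative degree forces a coordinate
  of size at least \<open>t/a\<close> or \<open>t/b\<close> on the wrong side; neither fits inside the window.
\<close>

lemma deg_one_Gr_iff:
  assumes v: "v \<in> L" and deg: "deg v = 1"
  shows "v \<in> Gr \<longleftrightarrow> - b < v $ 1 \<and> v $ 3 < a"
proof
  have e: "v $ 1 + v $ 2 + v $ 3 = d" "a * v $ 1 - b * v $ 3 = t"
    using tradeD [OF v] deg by simp_all
  {
    assume Gr: "v \<in> Gr"
    have "\<not> a \<le> v $ 3"
    proof
      assume z: "a \<le> v $ 3"
      hence "b * a \<le> b * v $ 3" using b1 by simp
      moreover have "a * (d + b) = d * a + a * b" "2 * (a * (a + b)) = 2 * (a * a) + 2 * (a * b)"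
        "a * a \<ge> 0" by (simp_all add: algebra_simps)
      ultimately have "a * (d + b) \<le> a * v $ 1" using e(2) large_facts(3,6) by (simp only: mult.commute)
      hence "d + b \<le> v $ 1" using a1 by simp
      hence "conformal circuit v" using z a1 b1 d1 e(1) by (intro conformal_circuit) auto
      thus False using Gr circuit_trade circuit_nonzero deg unfolding Gr_iff by auto
    qed
    moreover have "\<not> v $ 1 \<le> - b"
    proof
      assume x: "v $ 1 \<le> - b"
      hence "a * v $ 1 \<le> a * (- b)" using a1 by (simp only: mult_le_cancel_left_pos)
      hence "b * v $ 3 \<le> b * (- a)" using e(2) large_facts by (simp add: mult.commute)
      hence "v $ 3 \<le> - a" using b1 by (simp only: mult_le_cancel_left_pos)
      hence "conformal (- circuit) v" using x a1 b1 d1 e(1) by (intro conformal_uminus_circuit) auto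
      thus False using Gr uminus_circuit deg unfolding Gr_iff by auto
    qed
    ultimately show "- b < v $ 1 \<and> v $ 3 < a" by simp
  }
  assume win: "- b < v $ 1 \<and> v $ 3 < a"
  have no_zero: False if u: "u \<in> L" "u \<noteq> 0" "conformal u v" "deg u = 0" for u
  proof -
    obtain k where k: "u $ 1 = k * b" "u $ 2 = - k * (a + b)" "u $ 3 = k * a"
      using deg_zero_trade u(1,4) by blast
    have "k \<noteq> 0" using u(2) k by (auto simp: vec_eq_iff forall_3)
    then consider "k \<ge> 1" | "k \<le> -1" by linarith
    thus False
    proof cases
      case 1
      hence "1 * a \<le> k * a" using a1 by (intro mult_right_mono) auto
      thus False using conformal_cases [OF u(3), of 3] k(3) win a1 by linarith
    next
      case 2
      hence "k * b \<le> -1 * b" using b1 by (intro mult_right_mono) auto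
      thus False using conformal_cases [OF u(3), of 1] k(1) win b1 by linarith
    qed
  qed
  have no_neg: False if u: "u \<in> L" "conformal u v" "deg u \<le> -1" for u
  proof -
    have "t * deg u \<le> t * (-1)" using u(3) large_facts(1,6) by (intro mult_left_mono) auto
    hence u_e: "a * u $ 1 - b * u $ 3 \<le> - t" using tradeD [OF u(1)] by simp
    have vu: "v $ 1 * a - b * v $ 3 > 0" using e large_facts by (simp add: mult.commute)
    note c1 = conformal_cases [OF u(2), of 1] and c3 = conformal_cases [OF u(2), of 3]
    show False
    proof (cases "0 \<le> u $ 1")
      case True
      hence "0 \<le> a * u $ 1" using a1 by simp
      hence "b * a \<le> b * u $ 3" using u_e large_facts by (simp add: mult.commute)
      hence "a \<le> u $ 3" using b1 by simp
      thus False using c3 win a1 by auto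
    next
      case False
      have "a * v $ 1 < 0" using c1 False a1 by (simp add: mult_pos_neg)
      hence "b * v $ 3 < 0" using vu by (simp add: mult.commute)
      hence "v $ 3 < 0" using b1 by (simp add: mult_less_0_iff)
      hence "u $ 3 \<le> 0" using c3 by linarith
      hence "b * u $ 3 \<le> 0" using b1 by (simp add: mult_nonneg_nonpos)
      hence "a * u $ 1 \<le> a * (- b)" using u_e large_facts by simp
      hence "u $ 1 \<le> - b" using a1 by (simp only: mult_le_cancel_left_pos)
      thus False using c1 win b1 by auto
    qed
  qed
  have False if u: "u \<in> L" "u \<noteq> 0" "u \<noteq> v" "conformal u v" for u
  proof -
    have w: "v - u \<in> L" "v - u \<noteq> 0" "conformal (v - u) v" "deg (v - u) = 1 - deg u"
      using u diff_trade [OF u(1) v] deg by (auto simp: conformal_def mult.commute)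
    consider "deg u \<le> -1" | "deg u = 0" | "deg (v - u) = 0" | "deg (v - u) \<le> -1"
      using w(4) by linarith
    thus False using no_zero no_neg u w by cases blast+
  qed
  moreover have "v \<noteq> 0" using deg deg_zero_vec by auto
  ultimately show "v \<in> Gr" using v unfolding Gr_iff by blast
qed

lemma Gr_deg_one:
  "finite {v \<in> Gr. deg v = 1}" "card {v \<in> Gr. deg v = 1} = card (line_points a b t)"
proof -
  have "bij_betw (\<lambda>v. (v $ 1, v $ 3)) {v \<in> Gr. deg v = 1} (line_points a b t)"
    unfolding bij_betw_def
  proof (intro conjI set_eqI iffI)
    show "inj_on (\<lambda>v. (v $ 1, v $ 3)) {v \<in> Gr. deg v = 1}"
    proof (rule inj_onI)
      fix u v assume "u \<in> {v \<in> Gr. deg v = 1}" "v \<in> {v \<in> Gr. deg v = 1}"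
        and e: "(u $ 1, u $ 3) = (v $ 1, v $ 3)"
      hence "u $ 1 + u $ 2 + u $ 3 = d" "v $ 1 + v $ 2 + v $ 3 = d"
        using tradeD(1) [of u] tradeD(1) [of v] unfolding Gr_iff by auto
      thus "u = v" using e by (auto simp: vec_eq_iff forall_3)
    qed
    fix p assume "p \<in> (\<lambda>v. (v $ 1, v $ 3)) ` {v \<in> Gr. deg v = 1}"
    then obtain v where v: "p = (v $ 1, v $ 3)" "v \<in> Gr" "deg v = 1" by auto
    hence "v \<in> L" unfolding Gr_iff by simp
    thus "p \<in> line_points a b t"
      using v deg_one_Gr_iff tradeD(2) [of v] by (simp add: line_points_def)
  next
    fix p assume "p \<in> line_points a b t"
    then obtain x z where p: "p = (x, z)" "a * x - b * z = t" "- b < x" "z < a"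
      by (auto simp: line_points_def)
    define v :: "int ^ 3" where "v = vector [x, d - x - z, z]"
    have "v \<in> L" "deg v = 1" using tradeI [of v 1] p by (simp_all add: v_def)
    hence "v \<in> {v \<in> Gr. deg v = 1}" using deg_one_Gr_iff p by (simp add: v_def)
    moreover have "p = (v $ 1, v $ 3)" using p by (simp add: v_def)
    ultimately show "p \<in> (\<lambda>v. (v $ 1, v $ 3)) ` {v \<in> Gr. deg v = 1}" by blast
  qed
  moreover have "t \<ge> 0" using large_facts(1,6) by simp
  hence "finite (line_points a b t)" by (rule finite_line_points [OF a1 b1])
  ultimately show "finite {v \<in> Gr. deg v = 1}"
    "card {v \<in> Gr. deg v = 1} = card (line_points a b t)"
    using bij_betw_finite bij_betw_same_card by blast+
qed

section \<open>Degree at least two\<close>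

text \<open>
  Eliminating the third, or the first, coordinate shows that trades with prescribed signs are the
  solutions of \<open>p x + q y = n m\<close> in nonnegative integers, with \<open>p = a + b\<close> and \<open>q\<close> one of \<open>b\<close>, \<open>a\<close>. This
  is the form to which \<open>lattice_point_below\<close> applies.
\<close>

lemma trade_coordinate_relations:
  assumes "v \<in> L"
  shows "t * v $ 2 = - ((t - d * a) * v $ 1) - (t + d * b) * v $ 3"
    and "(a + b) * v $ 1 + b * v $ 2 = (t + d * b) * deg v"
    and "(a + b) * (- v $ 3) + a * (- v $ 2) = (t - d * a) * deg v"
proof -
  show "t * v $ 2 = - ((t - d * a) * v $ 1) - (t + d * b) * v $ 3"
    using assms by (simp add: L_def trade_lattice_M_gens)
  have "b * (v $ 1 + v $ 2 + v $ 3) = b * (d * deg v)"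
    "a * (v $ 1 + v $ 2 + v $ 3) = a * (d * deg v)"
    using tradeD(1) [OF assms] by simp_all
  thus "(a + b) * v $ 1 + b * v $ 2 = (t + d * b) * deg v"
    "(a + b) * (- v $ 3) + a * (- v $ 2) = (t - d * a) * deg v"
    using tradeD(2) [OF assms] by (simp_all add: algebra_simps)
qed

lemma third_nonpos:
  assumes "v \<in> L" "0 \<le> v $ 1" "0 \<le> v $ 2"
  shows "v $ 3 \<le> 0"
proof (rule ccontr)
  assume "\<not> v $ 3 \<le> 0"
  hence "0 < (t + d * b) * v $ 3" using large_facts by (intro mult_pos_pos) auto
  moreover have "0 \<le> (t - d * a) * v $ 1" "0 \<le> t * v $ 2"
    using assms large_facts by auto
  ultimately show False using trade_coordinate_relations(1) [OF assms(1)] by linarith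
qed

lemma first_nonneg:
  assumes "v \<in> L" "v $ 3 \<le> 0" "v $ 2 \<le> 0"
  shows "0 \<le> v $ 1"
proof (rule ccontr)
  assume "\<not> 0 \<le> v $ 1"
  hence "(t - d * a) * v $ 1 < 0" using large_facts by (intro mult_pos_neg) auto
  moreover have "(t + d * b) * v $ 3 \<le> 0" "t * v $ 2 \<le> 0"
    using assms large_facts by (auto intro!: mult_nonneg_nonpos)
  ultimately show False using trade_coordinate_relations(1) [OF assms(1)] by linarith
qed

text \<open>
  If no coordinate is small, the sign pattern decides what can be split off. When \<open>v\<^sub>1\<close> and \<open>v\<^sub>3\<close> have the
  same sign, \<open>v\<^sub>2\<close> has the opposite one and the circuit or its negative is a summand. When \<open>v\<^sub>1 > 0 > v\<^sub>3\<close>,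
  \<open>lattice_point_below\<close> finds a summand of degree \<open>1\<close>, matching the two coordinates that share their sign;
  the third coordinate then has the right sign for both summands. Positive degree excludes the remaining
  pattern.
\<close>

lemma deg_ge_two_Gr_near_ray:
  assumes "v \<in> Gr" and m: "2 \<le> deg v"
  shows "\<bar>v $ 1\<bar> < b \<or> \<bar>v $ 2\<bar> < a + b \<or> \<bar>v $ 3\<bar> < a"
proof (rule ccontr)
  assume "\<not> ?thesis"
  hence far: "b \<le> \<bar>v $ 1\<bar>" "a + b \<le> \<bar>v $ 2\<bar>" "a \<le> \<bar>v $ 3\<bar>" by auto
  have v: "v \<in> L" using assms unfolding Gr_iff by simp
  note rel = trade_coordinate_relations [OF v]
  have red: False if "u \<in> L" "conformal u v" "u \<noteq> 0" "deg u \<le> 1" for u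
    using assms that unfolding Gr_iff by auto
  have red1: False if "u \<in> L" "conformal u v" "deg u = 1" for u
  proof -
    have "u \<noteq> 0" using that(3) deg_zero_vec by auto
    thus False using red [of u] that by simp
  qed
  have cop': "coprime (a + b) b" "coprime (a + b) a"
    using cop gcd_add1 [of a b] gcd_add1 [of b a]
    by (simp_all only: coprime_iff_gcd_eq_1 add.commute gcd.commute)
  have big: "(a + b) * b \<le> t + d * b" "(a + b) * a \<le> t - d * a"
  proof -
    have "0 < a * (a + b)" "0 < b * (a + b)" using a1 b1 by (intro mult_pos_pos; simp)+
    thus "(a + b) * b \<le> t + d * b" "(a + b) * a \<le> t - d * a"
      using large_facts(3,4) unfolding mult.commute [of "a + b"] by linarith+
  qed
  consider "v $ 1 < 0" "v $ 3 > 0" | "v $ 1 > 0" "v $ 3 > 0" | "v $ 1 < 0" "v $ 3 < 0"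
    | "v $ 1 > 0" "v $ 3 < 0" "v $ 2 > 0" | "v $ 1 > 0" "v $ 3 < 0" "v $ 2 < 0"
    using far a1 b1 by fastforce
  thus False
  proof cases
    case 1
    have "a * v $ 1 < 0" "b * v $ 3 > 0" "t * deg v > 0"
      using 1 a1 b1 m large_facts by (auto intro!: mult_pos_neg mult_pos_pos)
    thus False using tradeD(2) [OF v] by linarith
  next
    case 2
    have "\<not> 0 \<le> v $ 2" using third_nonpos [OF v] 2 by auto
    hence "conformal circuit v" using far 2 a1 b1 by (intro conformal_circuit) auto
    thus False using red [OF circuit_trade(1)] circuit_trade(2) circuit_nonzero by simp
  next
    case 3
    have "\<not> v $ 2 \<le> 0" using first_nonneg [OF v] 3 by auto
    hence "conformal (- circuit) v" using far 3 a1 b1 by (intro conformal_uminus_circuit) auto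
    thus False using red [OF uminus_circuit(1)] uminus_circuit by simp
  next
    case 4
    have n: "(t + d * b) * 2 \<le> (t + d * b) * deg v"
      using m large_facts(1,6,7) by (intro mult_left_mono) auto
    have "2 * (t + d * b) \<le> (a + b) * v $ 1 + b * v $ 2" using n unfolding rel(2) by simp
    moreover have "b \<le> v $ 1" "a + b \<le> v $ 2" "0 < a + b" "0 < b" using far 4 a1 b1 by linarith+
    ultimately obtain x y where xy: "(a + b) * x + b * y = t + d * b"
      "0 \<le> x" "x \<le> v $ 1" "0 \<le> y" "y \<le> v $ 2"
      using lattice_point_below [of "a + b" b "t + d * b" "v $ 1" "v $ 2"] cop'(1) big(1) by blast
    define u :: "int ^ 3" where "u = vector [x, y, d - x - y]"
    have u: "u \<in> L" "deg u = 1"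
      using tradeI [of u 1] xy(1) by (simp_all add: u_def algebra_simps)
    have "u $ 3 \<le> 0" "(v - u) $ 3 \<le> 0"
      using third_nonpos [OF u(1)] third_nonpos [OF diff_trade(1) [OF u(1) v]] xy
      by (simp_all add: u_def)
    hence "conformal u v"
      unfolding conformal_def sub_interval_iff forall_3 using xy by (simp add: u_def)
    thus False using red1 u by blast
  next
    case 5
    have n: "(t - d * a) * 2 \<le> (t - d * a) * deg v"
      using m large_facts(2) by (intro mult_left_mono) auto
    have "2 * (t - d * a) \<le> (a + b) * (- v $ 3) + a * (- v $ 2)" using n unfolding rel(3) by simp
    moreover have "a \<le> - v $ 3" "a + b \<le> - v $ 2" "0 < a + b" "0 < a" using far 5 a1 b1 by linarith+
    ultimately obtain z y where zy: "(a + b) * z + a * y = t - d * a"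
      "0 \<le> z" "z \<le> - v $ 3" "0 \<le> y" "y \<le> - v $ 2"
      using lattice_point_below [of "a + b" a "t - d * a" "- v $ 3" "- v $ 2"] cop'(2) big(2) by blast
    define u :: "int ^ 3" where "u = vector [d + z + y, - y, - z]"
    have u: "u \<in> L" "deg u = 1"
      using tradeI [of u 1] zy(1) by (simp_all add: u_def algebra_simps)
    have "0 \<le> u $ 1" "0 \<le> (v - u) $ 1"
      using first_nonneg [OF u(1)] first_nonneg [OF diff_trade(1) [OF u(1) v]] zy
      by (simp_all add: u_def)
    hence "conformal u v"
      unfolding conformal_def sub_interval_iff forall_3 using zy by (simp add: u_def)
    thus False using red1 u by blast
  qed
qed

end

section \<open>Trades near a ray\<close>

text \<open>
  The three rays \<open>v\<^sub>i = 0\<close> are treated alike by letting \<open>i\<close>, \<open>j\<close>, \<open>k\<close> be an arrangement of the coordinates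
  in which \<open>j\<close> has a smaller shift than \<open>k\<close>. Then \<open>v\<^sub>j\<close> is positive and \<open>v\<^sub>k\<close> is negative on the
  half of the ray of positive degree.
\<close>

locale shifted_ray = shifted_generators +
  fixes i j k :: 3
  assumes distinct: "i \<noteq> j" "i \<noteq> k" "j \<noteq> k"
    and order: "shift $ j < shift $ k"
    and cop_ray: "coprime (shift $ k - shift $ j)
      (shift $ k - shift $ i)"
begin

abbreviation "\<alpha> \<equiv> shift $ i"
abbreviation "\<beta> \<equiv> shift $ j"
abbreviation "\<gamma> \<equiv> shift $ k"

lemma cover: "l = i \<or> l = j \<or> l = k"
  using distinct exhaust_3 [of i] exhaust_3 [of j] exhaust_3 [of k] exhaust_3 [of l] by auto

lemma sum_reorder:
  fixes f :: "3 \<Rightarrow> int"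
  shows "f 1 + f 2 + f 3 = f i + f j + f k"
  using distinct exhaust_3 [of i] exhaust_3 [of j] exhaust_3 [of k] by auto

lemma ray_tradeI:
  assumes "v $ i + v $ j + v $ k = d * m" "\<alpha> * v $ i + \<beta> * v $ j + \<gamma> * v $ k = - (t * m)"
  shows "v \<in> L" "deg v = m"
  using tradeI [of v m] assms sum_reorder [of "\<lambda>l. v $ l"] sum_reorder [of "\<lambda>l. shift $ l * v $ l"]
  by simp_all

lemma ray_tradeD:
  assumes "v \<in> L"
  shows "v $ i + v $ j + v $ k = d * deg v"
    "\<alpha> * v $ i + \<beta> * v $ j + \<gamma> * v $ k = - (t * deg v)"
  using tradeD [OF assms] sum_reorder [of "\<lambda>l. v $ l"] sum_reorder [of "\<lambda>l. shift $ l * v $ l"]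
  by simp_all

lemma other_coordinates:
  assumes "v \<in> L"
  shows "(\<gamma> - \<beta>) * v $ j = (t + d * \<gamma>) * deg v - (\<gamma> - \<alpha>) * v $ i"
    "(\<gamma> - \<beta>) * v $ k = (\<beta> - \<alpha>) * v $ i - (t + d * \<beta>) * deg v"
proof -
  note h = ray_tradeD [OF assms]
  have "\<gamma> * (v $ i + v $ j + v $ k) = \<gamma> * (d * deg v)" "\<beta> * (v $ i + v $ j + v $ k) = \<beta> * (d * deg v)"
    using h(1) by simp_all
  thus "(\<gamma> - \<beta>) * v $ j = (t + d * \<gamma>) * deg v - (\<gamma> - \<alpha>) * v $ i"
    "(\<gamma> - \<beta>) * v $ k = (\<beta> - \<alpha>) * v $ i - (t + d * \<beta>) * deg v"
    using h(2) by (simp_all add: algebra_simps)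
qed

lemma trade_eqI:
  assumes "u \<in> L" "v \<in> L" "deg u = deg v" "u $ i = v $ i"
  shows "u = v"
proof -
  have "(\<gamma> - \<beta>) * u $ j = (\<gamma> - \<beta>) * v $ j" "(\<gamma> - \<beta>) * u $ k = (\<gamma> - \<beta>) * v $ k"
    using other_coordinates [OF assms(1)] other_coordinates [OF assms(2)] assms(3,4) by simp_all
  hence "u $ j = v $ j" "u $ k = v $ k" using order by simp_all
  hence "u $ l = v $ l" for l using cover [of l] assms(4) by (elim disjE) simp_all
  thus ?thesis by (simp add: vec_eq_iff)
qed

lemma trade_in_ray_lattice:
  assumes "v \<in> L"
  shows "(deg v, v $ i) \<in> ray_lattice \<alpha> \<beta> \<gamma> d t"
  using dvd_triv_left [of "\<gamma> - \<beta>" "v $ j"] unfolding other_coordinates(1) [OF assms]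
  by (simp add: ray_lattice_def)

lemma ray_lattice_lift:
  assumes "(m, r) \<in> ray_lattice \<alpha> \<beta> \<gamma> d t"
  obtains v where "v \<in> L" "deg v = m" "v $ i = r"
proof -
  obtain p where p: "(t + d * \<gamma>) * m - (\<gamma> - \<alpha>) * r = (\<gamma> - \<beta>) * p"
    using assms by (auto simp: ray_lattice_def)
  define v :: "int ^ 3" where "v = (\<chi> l. if l = i then r else if l = j then p else d * m - r - p)"
  have v: "v $ i = r" "v $ j = p" "v $ k = d * m - r - p" using distinct by (simp_all add: v_def)
  have "v \<in> L" "deg v = m"
    using ray_tradeI [of v m] p unfolding v by (simp_all add: algebra_simps)
  thus thesis using that v(1) by blast
qed

lemma shift_bounds:
  "\<bar>\<gamma> - \<alpha>\<bar> \<le> a + b" "\<bar>\<beta> - \<alpha>\<bar> \<le> a + b" "\<gamma> - \<beta> \<le> a + b"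
  "t - d * a \<le> t + d * \<gamma>" "t - d * a \<le> t + d * \<beta>"
proof -
  have r: "- a \<le> shift $ l \<and> shift $ l \<le> b" for l
    using exhaust_3 [of l] a1 b1 by auto
  show "\<bar>\<gamma> - \<alpha>\<bar> \<le> a + b" "\<bar>\<beta> - \<alpha>\<bar> \<le> a + b" "\<gamma> - \<beta> \<le> a + b"
    using r [of i] r [of j] r [of k] by linarith+
  have "d * (- a) \<le> d * \<gamma>" "d * (- a) \<le> d * \<beta>"
    using r [of k] r [of j] d1 by (intro mult_left_mono; simp)+
  thus "t - d * a \<le> t + d * \<gamma>" "t - d * a \<le> t + d * \<beta>" by simp_all
qed

lemma offset_bound:
  fixes e r :: int
  assumes "\<bar>e\<bar> \<le> a + b" "\<bar>r\<bar> < \<gamma> - \<beta>"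
  shows "\<bar>e * r\<bar> \<le> (a + b)\<^sup>2"
proof -
  have "\<bar>e\<bar> * \<bar>r\<bar> \<le> (a + b) * (a + b)"
    using assms shift_bounds(3) a1 b1 by (intro mult_mono) auto
  thus ?thesis by (simp add: abs_mult power2_eq_square)
qed

text \<open>
  In \<open>other_coordinates\<close> the term containing the degree is at least \<open>t - d a\<close> in absolute value and
  outweighs the contribution of the small coordinate.
\<close>

lemma near_ray_others_large:
  assumes "v \<in> L" "1 \<le> deg v" "\<bar>v $ i\<bar> < \<gamma> - \<beta>"
  shows "a + b < v $ j" "v $ k < - (a + b)"
proof -
  have q: "(\<gamma> - \<beta>) * (a + b) \<le> (a + b)\<^sup>2"
    unfolding power2_eq_square using shift_bounds(3) a1 b1 by (intro mult_right_mono) auto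
  have pos: "0 \<le> t + d * \<gamma>" "0 \<le> t + d * \<beta>" using shift_bounds(4,5) large_facts by linarith+
  have m: "t - d * a \<le> (t + d * \<gamma>) * deg v" "t - d * a \<le> (t + d * \<beta>) * deg v"
    by (rule order_trans [OF shift_bounds(4)], use mult_left_mono [OF assms(2) pos(1)] in simp)
       (rule order_trans [OF shift_bounds(5)], use mult_left_mono [OF assms(2) pos(2)] in simp)
  note o = other_coordinates [OF assms(1)]
  have "(\<gamma> - \<beta>) * (a + b) < (\<gamma> - \<beta>) * v $ j"
    using q m(1) o(1) offset_bound [OF shift_bounds(1) assms(3)] large_facts(5) by linarith
  thus "a + b < v $ j" using order by simp
  have "(\<gamma> - \<beta>) * v $ k < (\<gamma> - \<beta>) * (- (a + b))"
    using q m(2) o(2) offset_bound [OF shift_bounds(2) assms(3)] large_facts(5) by (simp only: mult_minus_right)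
  thus "v $ k < - (a + b)" using order by (simp only: mult_less_cancel_left_pos diff_gt_0_iff_gt)
qed

text \<open>
  A negative degree would make \<open>v\<^sub>j\<close> negative. A trade of degree \<open>0\<close> is a multiple of the circuit, whose
  \<open>i\<close>-coordinate is \<open>\<plusminus>(\<gamma> - \<beta>)\<close>; here this appears as divisibility of \<open>v\<^sub>i\<close> by \<open>\<gamma> - \<beta>\<close>.
\<close>

lemma near_ray_deg_pos:
  assumes "v \<in> L" "v \<noteq> 0" "\<bar>v $ i\<bar> < \<gamma> - \<beta>" "0 \<le> v $ j"
  shows "1 \<le> deg v"
proof (rule ccontr)
  assume "\<not> 1 \<le> deg v"
  then consider "1 \<le> - deg v" | "deg v = 0" by linarith
  thus False
  proof cases
    case 1
    have "0 < - v $ j"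
      using near_ray_others_large(1) [of "- v"] uminus_trade [OF assms(1)] 1 assms(3) a1 b1 by simp
    thus False using assms(4) by simp
  next
    case 2
    have "\<gamma> - \<beta> dvd (\<gamma> - \<alpha>) * v $ i"
      using trade_in_ray_lattice [OF assms(1)] 2 by (simp add: ray_lattice_def)
    hence "\<gamma> - \<beta> dvd v $ i" using cop_ray by (simp add: coprime_dvd_mult_right_iff)
    hence "\<bar>\<gamma> - \<beta>\<bar> \<le> \<bar>v $ i\<bar>" if "v $ i \<noteq> 0" using that dvd_imp_le_int by blast
    hence "v $ i = 0" using assms(3) by linarith
    hence "v = 0" using trade_eqI [OF assms(1), of 0] tradeI [of 0 0] 2 by simp
    thus False using assms(2) by simp
  qed
qed

text \<open>
  Summands of a trade near the ray are again near the ray and have positive degree, hence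
  give a decomposition of the pair \<open>(deg v, v\<^sub>i)\<close>. Conversely any decomposition of the pair into parts of
  positive degree lifts to trades, whose \<open>j\<close>- and \<open>k\<close>-coordinates have the signs of those of \<open>v\<close> by
  \<open>near_ray_others_large\<close>.
\<close>

lemma near_ray_Gr_iff:
  assumes v: "v \<in> L" and m: "2 \<le> deg v" and near: "\<bar>v $ i\<bar> < \<gamma> - \<beta>"
  shows "v \<in> Gr \<longleftrightarrow> (deg v, v $ i) \<in> ray_atoms \<alpha> \<beta> \<gamma> d t"
proof
  have "1 \<le> deg v" using m by simp
  note v_large = near_ray_others_large [OF v this near]
  have v0: "0 < v $ j" "v $ k < 0" using v_large a1 b1 by linarith+
  {
    assume Gr: "v \<in> Gr"
    have False if h: "(m', r') \<in> ray_lattice \<alpha> \<beta> \<gamma> d t" "0 < m'" "m' < deg v"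
      "0 \<le> r' * (v $ i - r')" for m' r'
    proof -
      obtain u where u: "u \<in> L" "deg u = m'" "u $ i = r'" using ray_lattice_lift h(1) by blast
      note w = diff_trade [OF u(1) v]
      have near': "\<bar>u $ i\<bar> < \<gamma> - \<beta>" "\<bar>(v - u) $ i\<bar> < \<gamma> - \<beta>"
        using h(4) near unfolding u(3) sub_interval_iff vector_minus_component by linarith+
      have "1 \<le> deg u" "1 \<le> deg (v - u)" using u(2) w(2) h(2,3) by linarith+
      from near_ray_others_large [OF u(1) this(1) near'(1)]
        near_ray_others_large [OF w(1) this(2) near'(2)]
      have signs: "0 < u $ j" "u $ k < 0" "u $ j < v $ j" "v $ k < u $ k"
        using a1 b1 unfolding vector_minus_component by linarith+
      have "0 \<le> u $ l * (v $ l - u $ l)" for l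
        using cover [of l]
      proof (elim disjE)
        show "l = i \<Longrightarrow> ?thesis" using h(4) u(3) by simp
      qed (use signs in \<open>simp_all add: sub_interval_iff\<close>)
      hence "conformal u v" by (simp add: conformal_def)
      moreover have "u \<noteq> 0" "u \<noteq> v" using signs(1,3) by auto
      ultimately show False using Gr u(1) unfolding Gr_iff by blast
    qed
    thus "(deg v, v $ i) \<in> ray_atoms \<alpha> \<beta> \<gamma> d t"
      using trade_in_ray_lattice [OF v] m near unfolding ray_atoms_def by auto
  }
  assume atom: "(deg v, v $ i) \<in> ray_atoms \<alpha> \<beta> \<gamma> d t"
  have False if u: "u \<in> L" "u \<noteq> 0" "u \<noteq> v" "conformal u v" for u
  proof -
    have near': "\<bar>u $ i\<bar> < \<gamma> - \<beta>" "\<bar>(v - u) $ i\<bar> < \<gamma> - \<beta>" "0 \<le> u $ j" "0 \<le> (v - u) $ j"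
      using conformal_cases [OF u(4), of i] conformal_cases [OF u(4), of j] near v0
      unfolding vector_minus_component by linarith+
    note w = diff_trade [OF u(1) v]
    have "1 \<le> deg u" using near_ray_deg_pos [OF u(1,2) near'(1,3)] .
    moreover have "v - u \<noteq> 0" using u(3) by simp
    hence "1 \<le> deg (v - u)" using near_ray_deg_pos [OF w(1) _ near'(2,4)] by simp
    moreover have "0 \<le> u $ i * (v $ i - u $ i)" using u(4) by (simp add: conformal_def)
    ultimately show False
      using atom trade_in_ray_lattice [OF u(1)] w(2) unfolding ray_atoms_def by fastforce
  qed
  moreover have "v \<noteq> 0" using v0 by auto
  ultimately show "v \<in> Gr" using v unfolding Gr_iff by blast
qed

lemma near_ray_Gr:
  defines "H \<equiv> {v \<in> Gr. 2 \<le> deg v \<and> \<bar>v $ i\<bar> < \<gamma> - \<beta>}"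
  shows "finite H" "card H = card (ray_atoms \<alpha> \<beta> \<gamma> d t)"
proof -
  have "bij_betw (\<lambda>v. (deg v, v $ i)) H (ray_atoms \<alpha> \<beta> \<gamma> d t)"
    unfolding bij_betw_def
  proof (intro conjI set_eqI iffI)
    show "inj_on (\<lambda>v. (deg v, v $ i)) H"
      by (rule inj_onI) (use trade_eqI in \<open>simp add: H_def Gr_iff\<close>)
    fix p assume "p \<in> (\<lambda>v. (deg v, v $ i)) ` H"
    then obtain v where v: "p = (deg v, v $ i)" "v \<in> Gr" "2 \<le> deg v" "\<bar>v $ i\<bar> < \<gamma> - \<beta>"
      unfolding H_def by blast
    hence "v \<in> L" unfolding Gr_iff by simp
    thus "p \<in> ray_atoms \<alpha> \<beta> \<gamma> d t" using near_ray_Gr_iff [of v] v by simp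
  next
    fix p assume p: "p \<in> ray_atoms \<alpha> \<beta> \<gamma> d t"
    obtain m r where mr: "p = (m, r)" by fastforce
    hence h: "(m, r) \<in> ray_lattice \<alpha> \<beta> \<gamma> d t" "2 \<le> m" "\<bar>r\<bar> < \<gamma> - \<beta>"
      using p by (auto simp: ray_atoms_def)
    obtain v where v: "v \<in> L" "deg v = m" "v $ i = r" using ray_lattice_lift h(1) by blast
    have "v \<in> H" using near_ray_Gr_iff [OF v(1)] v h p mr by (simp add: H_def)
    thus "p \<in> (\<lambda>v. (deg v, v $ i)) ` H" using v mr by force
  qed
  thus "finite H" "card H = card (ray_atoms \<alpha> \<beta> \<gamma> d t)"
    using finite_ray_atoms bij_betw_finite bij_betw_same_card by blast+
qed

end

section \<open>Counting\<close>

context shifted_generators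
begin

lemma card_Gr:
  "card Gr = 2 + 2 * (card (line_points a b t) + card (ray_atoms (- a) 0 b d t)
     + card (ray_atoms 0 (- a) b d t) + card (ray_atoms b (- a) 0 d t))"
proof -
  have ab: "gcd a b = 1" "gcd b a = 1" "gcd (b + a) b = 1"
    using cop gcd_add1 [of a b] by (simp_all add: coprime_iff_gcd_eq_1 gcd.commute add.commute)
  interpret r1: shifted_ray a b d t 1 2 3
    by unfold_locales (use a1 b1 ab in \<open>simp_all add: coprime_iff_gcd_eq_1\<close>)
  interpret r2: shifted_ray a b d t 2 1 3
    by unfold_locales (use a1 b1 ab in \<open>simp_all add: coprime_iff_gcd_eq_1\<close>)
  interpret r3: shifted_ray a b d t 3 1 2
    by unfold_locales (use a1 b1 ab in \<open>simp_all add: coprime_iff_gcd_eq_1\<close>)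
  define D where "D = {v \<in> Gr. deg v = 1}"
  define H1 where "H1 = {v \<in> Gr. 2 \<le> deg v \<and> \<bar>v $ 1\<bar> < b}"
  define H2 where "H2 = {v \<in> Gr. 2 \<le> deg v \<and> \<bar>v $ 2\<bar> < a + b}"
  define H3 where "H3 = {v \<in> Gr. 2 \<le> deg v \<and> \<bar>v $ 3\<bar> < a}"
  define P where "P = {v \<in> Gr. 0 < deg v}"
  have D: "finite D" "card D = card (line_points a b t)"
    unfolding D_def by (rule Gr_deg_one)+
  have H1: "finite H1" "card H1 = card (ray_atoms (- a) 0 b d t)"
    using r1.near_ray_Gr by (simp_all add: H1_def)
  have H2: "finite H2" "card H2 = card (ray_atoms 0 (- a) b d t)"
    using r2.near_ray_Gr by (simp_all add: H2_def add.commute)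
  have H3: "finite H3" "card H3 = card (ray_atoms b (- a) 0 d t)"
    using r3.near_ray_Gr by (simp_all add: H3_def)
  have far1: "v $ 2 > a + b \<and> v $ 3 < - (a + b)" if "v \<in> H1" for v
    using that r1.near_ray_others_large [of v] by (auto simp: H1_def Gr_iff)
  have far2: "v $ 3 < - (a + b)" if "v \<in> H2" for v
    using that r2.near_ray_others_large [of v] by (auto simp: H2_def Gr_iff)
  have disj: "D \<inter> (H1 \<union> (H2 \<union> H3)) = {}" "H1 \<inter> (H2 \<union> H3) = {}" "H2 \<inter> H3 = {}"
    using far1 far2 a1 b1 by (fastforce simp: D_def H1_def H2_def H3_def)+
  have P: "P = D \<union> (H1 \<union> (H2 \<union> H3))"
  proof (intro set_eqI iffI)
    fix v assume v: "v \<in> P"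
    hence "v \<in> Gr" "deg v = 1 \<or> 2 \<le> deg v" unfolding P_def by auto
    thus "v \<in> D \<union> (H1 \<union> (H2 \<union> H3))"
      using deg_ge_two_Gr_near_ray [of v] unfolding D_def H1_def H2_def H3_def by blast
  qed (auto simp: P_def D_def H1_def H2_def H3_def)
  have finP: "finite P" unfolding P using D H1 H2 H3 by simp
  have cardP: "card P = card D + (card H1 + (card H2 + card H3))"
    unfolding P using D(1) H1(1) H2(1) H3(1) disj by (simp add: card_Un_disjoint)
  have posP: "0 < deg v" if "v \<in> P" for v
    using that by (simp add: P_def)
  have negP: "deg v < 0" if "v \<in> uminus ` P" for v
    using that uminus_trade(2) by (auto simp: P_def Gr_iff)
  define Z where "Z = {v \<in> Gr. deg v = 0}"
  have Z: "Z = {circuit, - circuit}" unfolding Z_def by (rule Gr_deg_zero)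
  have Gr: "Gr = Z \<union> (P \<union> uminus ` P)"
  proof (intro set_eqI iffI)
    fix v assume v: "v \<in> Gr"
    have neg: "v \<in> uminus ` P" if "deg v < 0"
    proof
      show "v = - (- v)" by simp
      show "- v \<in> P" using that v uminus_Gr [OF v] uminus_trade(2) [of v] unfolding P_def Gr_iff by auto
    qed
    consider "deg v < 0" | "deg v = 0" | "0 < deg v" by linarith
    thus "v \<in> Z \<union> (P \<union> uminus ` P)"
      using neg v unfolding P_def Z_def by cases simp_all
  next
    fix v assume "v \<in> Z \<union> (P \<union> uminus ` P)"
    thus "v \<in> Gr" using uminus_Gr unfolding P_def Z_def by blast
  qed
  have "circuit \<noteq> - circuit" using a1 by (auto simp: vec_eq_iff forall_3)
  hence "card Z = 2" "finite Z" unfolding Z by simp_all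
  moreover have "card (uminus ` P) = card P" by (simp add: card_image)
  moreover have "P \<inter> uminus ` P = {}" using posP negP by (meson disjoint_iff less_asym)
  hence "card (P \<union> uminus ` P) = card P + card (uminus ` P)"
    using finP by (intro card_Un_disjoint) simp_all
  moreover have "Z \<inter> (P \<union> uminus ` P) = {}"
    using posP negP unfolding Z_def disjoint_iff Un_iff mem_Collect_eq by (metis less_irrefl)
  hence "card Gr = card Z + card (P \<union> uminus ` P)"
    unfolding Gr using finP \<open>finite Z\<close> by (intro card_Un_disjoint) simp_all
  ultimately show ?thesis using cardP D H1 H2 H3 by simp
qed

end

theorem theorem1p1:
  fixes a b d \<rho> :: int
  assumes "a \<ge> 1" and "b \<ge> 1" and "d \<ge> 1"
    and "gcd a b = 1"
    and "\<rho> = d * a * b * (a + b)"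
  shows "(\<exists>(N :: int) (c :: int \<Rightarrow> rat).
            (\<forall>t. c (t + \<rho>) = c t) \<and>
            (\<forall>t. t > d * a \<and> gcd t d = 1 \<and> t > N \<longrightarrow>
               of_nat (card (graver_basis (M_gens a b d t)))
                 = 2 / of_int (a * b) * of_int t + c t))
       \<and> (\<exists>N :: int.
            \<forall>t. t > d * a \<and> gcd t d = 1 \<and> t > N \<longrightarrow>
              int (card (graver_basis (M_gens a b d (t + \<rho>))))
                = int (card (graver_basis (M_gens a b d t))) + 2 * d * (a + b))"
proof -
  have cop: "coprime a b" using assms(4) by (simp add: coprime_iff_gcd_eq_1)
  have \<rho>0: "\<rho> > 0" using assms by simp
  define J where "J t = card (ray_atoms (- a) 0 b d t) + card (ray_atoms 0 (- a) b d t)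
    + card (ray_atoms b (- a) 0 d t)" for t
  have J: "J (t + \<rho>) = J t" for t
  proof -
    have "b - 0 dvd \<rho>" "b - (- a) dvd \<rho>" "0 - (- a) dvd \<rho>"
      unfolding assms(5) by (simp_all add: add.commute)
    thus ?thesis unfolding J_def by (simp only: ray_atoms_periodic)
  qed
  \<comment> \<open>Reducing \<open>t\<close> modulo \<open>\<rho>\<close> in the linear part makes \<open>c\<close> periodic; the removed part \<open>t div \<rho> * \<rho>\<close> is \<open>k\<close> steps of length \<open>a b\<close>.\<close>
  define c :: "int \<Rightarrow> rat" where "c t = 2 + 2 * (of_nat (card (line_points a b (t mod \<rho>))) + of_nat (J t))
    - 2 / of_int (a * b) * of_int (t mod \<rho>)" for t
  define N where "N = d * (a + b) + 2 * (a + b)\<^sup>2"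
  have c: "c (t + \<rho>) = c t" for t by (simp add: c_def J)
  have main: "of_nat (card (graver_basis (M_gens a b d t))) = 2 / of_int (a * b) * of_int t + c t"
    if t: "gcd t d = 1" "t > N" for t
  proof -
    interpret g: shifted_generators a b d t
      using assms cop t by unfold_locales (simp_all add: coprime_iff_gcd_eq_1 N_def)
    have "t > 0" using g.large_facts(1,6) by simp
    define k where "k = nat (t div \<rho> * (d * (a + b)))"
    have "0 \<le> t div \<rho>" using \<open>t > 0\<close> \<rho>0 by (simp add: pos_imp_zdiv_nonneg_iff)
    hence k: "int k = t div \<rho> * (d * (a + b))" using assms by (simp add: k_def)
    have "t = t mod \<rho> + t div \<rho> * \<rho>" by simp
    also have "t div \<rho> * \<rho> = int k * (a * b)" unfolding k assms(5) by (simp add: ac_simps)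
    finally have t_eq: "t = t mod \<rho> + int k * (a * b)" .
    have "card (line_points a b t) = card (line_points a b (t mod \<rho>)) + k"
      using card_line_points [OF assms(1,2) cop, of "t mod \<rho>" k] \<rho>0 t_eq by simp
    hence "card (graver_basis (M_gens a b d t)) = 2 + 2 * (card (line_points a b (t mod \<rho>)) + k + J t)"
      using g.card_Gr unfolding g.Gr_def J_def by simp
    moreover have "(of_int t :: rat) = of_int (t mod \<rho>) + of_nat k * of_int (a * b)"
      by (subst t_eq) simp
    moreover have "(of_int (a * b) :: rat) \<noteq> 0" using assms by simp
    ultimately show ?thesis by (simp add: c_def field_simps)
  qed
  have step: "int (card (graver_basis (M_gens a b d (t + \<rho>))))
      = int (card (graver_basis (M_gens a b d t))) + 2 * d * (a + b)"
    if t: "gcd t d = 1" "t > N" for t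
  proof -
    have "gcd (t + \<rho>) d = 1"
      using t(1) gcd_add_mult [of d "a * b * (a + b)" t] unfolding assms(5)
      by (simp add: ac_simps)
    moreover have "t + \<rho> > N" using t \<rho>0 by simp
    ultimately have "(of_nat (card (graver_basis (M_gens a b d (t + \<rho>)))) :: rat)
        = of_nat (card (graver_basis (M_gens a b d t))) + 2 / of_int (a * b) * of_int \<rho>"
      using main [of t] main [of "t + \<rho>"] t c by (simp add: distrib_left)
    also have "2 / of_int (a * b) * of_int \<rho> = (of_int (2 * d * (a + b)) :: rat)"
      using assms by (simp add: field_simps)
    finally have "(of_int (int (card (graver_basis (M_gens a b d (t + \<rho>))))) :: rat)
        = of_int (int (card (graver_basis (M_gens a b d t))) + 2 * d * (a + b))"
      by simp
    thus ?thesis unfolding of_int_eq_iff .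
  qed
  show ?thesis
    by (intro conjI exI [of _ N] exI [of _ c] allI impI; (elim conjE)?)
       (rule c, (rule main; assumption), (rule step; assumption))
qed

end
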